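(* Let $\mathcal{I}$ be an ideal on $\omega$ that is Borel-separated from its dual filter $\mathcal{I}^\star$, i.e., there is a Borel set $S\subseteq 2^\omega$ such that $\mathcal{I}\subseteq S$ and $\mathcal{I}^\star\cap S=\emptyset$. Then $\mathfrak{b}(\mathcal{I})\leq\mathfrak{d}$. In particular, $\mathfrak{b}(\mathcal{I})\leq\mathfrak{d}$ for every analytic ideal $\mathcal{I}$.
   Context: An ideal on a set $X$ is a family $\mathcal{I}\subseteq\mathcal{P}(X)$ closed under finite unions and subsets, containing all finite subsets of $X$, and with $X\notin\mathcal{I}$. By "ideal" we mean an ideal on some countable set $X$. Its dual filter is $\mathcal{I}^\star=\{A\subseteq X: X\setminus A\in\mathcal{I}\}$. Subsets of $X$ are identified with their characteristic functions, so $\mathcal{P}(X)$ carries the topology of the Cantor space $\{0,1\}^X$; an ideal is analytic if it is an analytic subset of $\{0,1\}^X$. For an ideal $\mathcal{I}$ on a countable set $X$ and $f,g\in\omega^X$ write $f\leq_{\mathcal{I}}g$ if $\{x\in X: f(x)>g(x)\}\in\mathcal{I}$, let $\mathcal{D}_{\mathcal{I}}=\{f\in\omega^X: f^{-1}[\{n\}]\in\mathcal{I}\text{ for every }n\in\omega\}$, and let $\mathfrak{b}(\mathcal{I})$ be the least cardinality of a family $\mathcal{F}\subseteq\mathcal{D}_{\mathcal{I}}$ such that there is no $g\in\mathcal{D}_{\mathcal{I}}$ with $g\leq_{\mathcal{I}}f$ for all $f\in\mathcal{F}$. Equivalently (a known characterization), $\mathfrak{b}(\mathcal{I})$ is the least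 cardinality of a family $\mathcal{E}$ of sequences $\langle E_n:n\in\omega\rangle$ of pairwise disjoint members of $\mathcal{I}$ such that for every sequence $\langle A_n:n\in\omega\rangle$ of pairwise disjoint members of $\mathcal{I}$ with $\bigcup_n A_n=X$ there is $\langle E_n\rangle\in\mathcal{E}$ with $\bigcup_{n\in\omega}\left(A_n\cap\bigcup_{i\leq n}E_i\right)\notin\mathcal{I}$. $\mathfrak{d}$ is the dominating number: the least size of a family $\mathcal{F}\subseteq\omega^\omega$ such that every $g\in\omega^\omega$ satisfies $g(n)\leq f(n)$ for all but finitely many $n$, for some $f\in\mathcal{F}$. *)

theory Defs
  imports "HOL-Analysis.Analysis"
begin

unbundle cardinal_syntax

definition ideal_on :: "'a set \<Rightarrow> 'a set set \<Rightarrow> bool" where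
  "ideal_on X I \<longleftrightarrow>
     I \<subseteq> Pow X \<and>
     (\<forall>A\<in>I. \<forall>B\<in>I. A \<union> B \<in> I) \<and>
     (\<forall>A\<in>I. \<forall>B. B \<subseteq> A \<longrightarrow> B \<in> I) \<and>
     (\<forall>A. finite A \<and> A \<subseteq> X \<longrightarrow> A \<in> I) \<and>
     X \<notin> I"

definition dual_filter :: "'a set \<Rightarrow> 'a set set \<Rightarrow> 'a set set" where
  "dual_filter X I = {A. A \<subseteq> X \<and> X - A \<in> I}"

text \<open>The two-point set is \<^typ>\<open>bool\<close>; points of the space are functions on \<open>X\<close>,
  i.e. functions that are \<^const>\<open>undefined\<close> outside \<open>X\<close>.\<close>

definition cantor_space :: "'a set \<Rightarrow> ('a \<Rightarrow> bool) topology" where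
  "cantor_space X = product_topology (\<lambda>_. discrete_topology UNIV) X"

definition char_fun :: "'a set \<Rightarrow> 'a set \<Rightarrow> 'a \<Rightarrow> bool" where
  "char_fun X A = (\<lambda>x\<in>X. x \<in> A)"

definition baire_space :: "(nat \<Rightarrow> nat) topology" where
  "baire_space = product_topology (\<lambda>_. discrete_topology UNIV) UNIV"

definition borel_sets_of :: "'b topology \<Rightarrow> 'b set set" where
  "borel_sets_of T = sigma_sets (topspace T) {U. openin T U}"

text \<open>Meant for Polish \<open>T\<close>: the empty set and the continuous images of the Baire space.\<close>

definition analytic_in :: "'b topology \<Rightarrow> 'b set \<Rightarrow> bool" where
  "analytic_in T A \<longleftrightarrow>
     A = {} \<or> (\<exists>f. continuous_map baire_space T f \<and> A = f ` topspace baire_space)"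

definition analytic_family :: "'a set \<Rightarrow> 'a set set \<Rightarrow> bool" where
  "analytic_family X I \<longleftrightarrow> analytic_in (cantor_space X) (char_fun X ` I)"

definition borel_separated :: "'a set \<Rightarrow> 'a set set \<Rightarrow> 'a set set \<Rightarrow> bool" where
  "borel_separated X I J \<longleftrightarrow>
     (\<exists>S\<in>borel_sets_of (cantor_space X). char_fun X ` I \<subseteq> S \<and> char_fun X ` J \<inter> S = {})"

text \<open>Cardinals are represented by cardinal orders, as in the library. Only meaningful for nonempty
  \<open>W\<close>, and then unique up to \<open>=o\<close>.\<close>

definition least_card :: "'b set set \<Rightarrow> 'b rel" where
  "least_card W = (SOME r. \<exists>A\<in>W. r = |A| \<and> (\<forall>B\<in>W. |A| \<le>o |B| ))"

lemma least_card_attained: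
  assumes "W \<noteq> {}"
  shows "\<exists>A\<in>W. least_card W = |A| \<and> (\<forall>B\<in>W. |A| \<le>o |B| )"
proof -
  have "\<exists>r\<in>card_of ` W. \<forall>r'\<in>card_of ` W. r \<le>o r'"
    using assms by (intro exists_minim_Card_order) (auto simp: card_of_Card_order)
  then have "\<exists>r. \<exists>A\<in>W. r = |A| \<and> (\<forall>B\<in>W. |A| \<le>o |B| )"
    by blast
  then show ?thesis
    unfolding least_card_def by (rule someI_ex)
qed

definition le_mod :: "'a set \<Rightarrow> 'a set set \<Rightarrow> ('a \<Rightarrow> nat) \<Rightarrow> ('a \<Rightarrow> nat) \<Rightarrow> bool" where
  "le_mod X I f g \<longleftrightarrow> {x\<in>X. f x > g x} \<in> I"

definition D_fun :: "'a set \<Rightarrow> 'a set set \<Rightarrow> ('a \<Rightarrow> nat) set" where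
  "D_fun X I = {f \<in> X \<rightarrow>\<^sub>E UNIV. \<forall>n. {x\<in>X. f x = n} \<in> I}"

definition unbounded_families :: "'a set \<Rightarrow> 'a set set \<Rightarrow> ('a \<Rightarrow> nat) set set" where
  "unbounded_families X I =
     {F. F \<subseteq> D_fun X I \<and> \<not> (\<exists>g\<in>D_fun X I. \<forall>f\<in>F. le_mod X I g f)}"

definition bounding_number :: "'a set \<Rightarrow> 'a set set \<Rightarrow> ('a \<Rightarrow> nat) rel" where
  "bounding_number X I = least_card (unbounded_families X I)"

definition dominating_families :: "(nat \<Rightarrow> nat) set set" where
  "dominating_families = {F. \<forall>g. \<exists>f\<in>F. \<forall>\<^sub>\<infinity>n. g n \<le> f n}"

definition dominating_number :: "(nat \<Rightarrow> nat) rel" where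
  "dominating_number = least_card dominating_families"

lemma dominating_families_nonempty: "dominating_families \<noteq> {}"
proof -
  have "\<exists>f. \<forall>\<^sub>\<infinity>n. g n \<le> f n" for g :: "nat \<Rightarrow> nat"
    by (rule exI[of _ g]) simp
  then have "UNIV \<in> dominating_families"
    by (simp add: dominating_families_def)
  then show ?thesis by blast
qed

lemma unbounded_families_nonempty:
  assumes I: "ideal_on X I"
  shows "unbounded_families X I \<noteq> {}"
proof -
  have "\<exists>f\<in>D_fun X I. \<not> le_mod X I g f" if g: "g \<in> D_fun X I" for g
  proof -
    define f where "f = (\<lambda>x\<in>X. g x div 2)"
    have fib: "{x\<in>X. g x = n} \<in> I" for n
      using g by (simp add: D_fun_def)
    have un: "A \<union> B \<in> I" if "A \<in> I" "B \<in> I" for A B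
      using I that by (simp add: ideal_on_def)
    have "{x\<in>X. f x = n} = {x\<in>X. g x = 2 * n} \<union> {x\<in>X. g x = 2 * n + 1}" for n
      by (auto simp: f_def)
    then have "f \<in> D_fun X I"
      using un[OF fib fib] by (simp add: D_fun_def) (simp add: f_def)
    moreover have "\<not> le_mod X I g f"
    proof
      assume "le_mod X I g f"
      then have "{x\<in>X. g x > f x} \<union> {x\<in>X. g x = 0} \<in> I"
        using un fib by (simp add: le_mod_def)
      moreover have "{x\<in>X. g x > f x} \<union> {x\<in>X. g x = 0} = X"
        by (auto simp: f_def)
      ultimately show False
        using I by (simp add: ideal_on_def)
    qed
    ultimately show ?thesis by blast
  qed
  then have "D_fun X I \<in> unbounded_families X I"
    by (auto simp: unbounded_families_def)
  then show ?thesis by blast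
qed

end

theory Submission
  imports Defs
begin

text \<open>If \<open>\<bb>(J)\<close> exceeded \<open>\<dd>\<close>, every Borel set \<open>C\<close> would be a pointwise \<open>J\<close>-limit of sets \<open>c x\<close>, \<open>x \<in> X\<close>, each
  depending only on the coordinates enumerated before \<open>x\<close>: given such approximations \<open>c k x\<close> of sets \<open>C k\<close>
  converging to \<open>C\<close>, put \<open>c x = c (g x) x\<close>, where \<open>g\<close> lies in \<open>\<D>\<^bsub>J\<^esub>\<close> and grows so slowly that the
  diagonal errors stay in \<open>J\<close>. For \<open>C = S\<close> separating \<open>J\<close> from its dual filter, the dependence on
  earlier coordinates allows to define a set \<open>z\<close> recursively by \<open>x \<in> z \<longleftrightarrow> z \<in> c x\<close>. Then \<open>z \<in> S\<close> puts
  \<open>z\<close> into the dual filter and \<open>z \<notin> S\<close> puts \<open>z\<close> into \<open>J\<close>, a contradiction either way. An analytic ideal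
  and its dual filter are disjoint analytic sets, so Lusin's separation theorem applies.\<close>

section \<open>Ideals and dominating families\<close>

lemma ideal_onD:
  assumes "ideal_on X J"
  shows ideal_on_Un: "A \<in> J \<Longrightarrow> B \<in> J \<Longrightarrow> A \<union> B \<in> J"
    and ideal_on_subset: "A \<in> J \<Longrightarrow> B \<subseteq> A \<Longrightarrow> B \<in> J"
    and ideal_on_finite: "finite A \<Longrightarrow> A \<subseteq> X \<Longrightarrow> A \<in> J"
    and ideal_on_whole: "X \<notin> J"
    and ideal_on_Pow: "A \<in> J \<Longrightarrow> A \<subseteq> X"
  using assms unfolding ideal_on_def by (meson Pow_iff subsetD)+

lemma ideal_on_finite_UN:
  assumes "ideal_on X J" "finite N" "\<And>n. n \<in> N \<Longrightarrow> A n \<in> J"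
  shows "(\<Union>n\<in>N. A n) \<in> J"
  using assms(2,3)
  by (induction N) (simp_all add: ideal_on_finite[OF assms(1)] ideal_on_Un[OF assms(1)])

lemma topspace_cantor_space: "topspace (cantor_space X) = X \<rightarrow>\<^sub>E UNIV"
  by (simp add: cantor_space_def)

text \<open>The successor of the sum of a finite family exceeds every member everywhere.\<close>

lemma infinite_if_dominating:
  assumes "D \<in> dominating_families"
  shows "infinite D"
proof
  assume fin: "finite D"
  obtain f where f: "f \<in> D" "\<forall>\<^sub>\<infinity>n. Suc (\<Sum>f\<in>D. f n) \<le> f n"
    using assms[unfolded dominating_families_def mem_Collect_eq,
        rule_format, of "\<lambda>n. Suc (\<Sum>f\<in>D. f n)"] by blast
  have "f n \<le> (\<Sum>f\<in>D. f n)" for n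
    using fin f(1) by (intro member_le_sum) auto
  then have "\<not> Suc (\<Sum>f\<in>D. f n) \<le> f n" for n
    by (simp add: not_le le_imp_less_Suc)
  then show False
    using f(2) by simp
qed

text \<open>Maxima with constants repair the finitely many failures of eventual domination. There
  are only countably many constants, so an infinite family does not grow in cardinality.\<close>

lemma everywhere_dominating_family:
  "\<exists>D :: (nat \<Rightarrow> nat) set. |D| \<le>o dominating_number \<and> (\<forall>h. \<exists>h'\<in>D. h \<le> h')"
proof -
  obtain D where D: "D \<in> dominating_families" "dominating_number = |D|"
    using least_card_attained[OF dominating_families_nonempty]
    unfolding dominating_number_def by blast
  define D' where "D' = (\<lambda>(f :: nat \<Rightarrow> nat, m) n. max (f n) m) ` (D \<times> (UNIV :: nat set))"
  have inf: "infinite D"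
    by (rule infinite_if_dominating[OF D(1)])
  have "|D'| \<le>o |D \<times> (UNIV :: nat set)|"
    unfolding D'_def by (rule card_of_image)
  also have "|D \<times> (UNIV :: nat set)| =o |D|"
    using inf by (intro card_of_Times_infinite_simps(1)) (auto simp: infinite_iff_card_of_nat)
  finally have "|D'| \<le>o dominating_number"
    by (simp add: D(2))
  moreover have "\<exists>h'\<in>D'. h \<le> h'" for h
  proof -
    obtain f where f: "f \<in> D" "\<forall>\<^sub>\<infinity>n. h n \<le> f n"
      using D(1) by (auto simp: dominating_families_def)
    then obtain N where N: "\<And>n. n \<ge> N \<Longrightarrow> h n \<le> f n"
      by (auto simp: MOST_nat_le)
    define m where "m = (\<Sum>n<N. h n)"
    have "h n \<le> m" if "n < N" for n
      unfolding m_def using that by (intro member_le_sum) auto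
    then have "h \<le> (\<lambda>n. max (f n) m)"
      by (metis N le_funI le_max_iff_disj linorder_not_le)
    moreover have "(\<lambda>n. max (f n) m) \<in> D'"
      using f(1) by (auto simp: D'_def)
    ultimately show ?thesis by blast
  qed
  ultimately show ?thesis by blast
qed

text \<open>For \<open>h\<close> in an everywhere dominating family, the first index at which a
  point enters \<open>E h\<close> gives, after a small correction, a member of
  \<open>D_fun X J\<close>. At most \<dd> such functions arise, so by \<open>b\<close> some member
  of \<open>D_fun X J\<close> lies below all of them modulo \<open>J\<close>; lowered by one, it
  picks an index before the entry. Monotonicity of \<open>E\<close> carries this over to all
  \<open>h\<close>.\<close>

lemma diagonalising_function:
  fixes E :: "(nat \<Rightarrow> nat) \<Rightarrow> nat \<Rightarrow> 'a set"
  assumes b: "\<not> bounding_number X J \<le>o dominating_number"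
    and X: "countable X" and J: "ideal_on X J"
    and E: "\<And>h k. E h k \<in> J" and mono: "mono E"
  shows "\<exists>g. (\<forall>n. {x\<in>X. g x \<le> n} \<in> J) \<and> (\<forall>h. {x\<in>X. x \<in> E h (g x)} \<in> J)"
proof -
  from everywhere_dominating_family obtain D :: "(nat \<Rightarrow> nat) set"
    where D: "|D| \<le>o dominating_number \<and> (\<forall>h. \<exists>h'\<in>D. h \<le> h')" ..
  \<comment> \<open>The second disjunct makes the least index exist even for points in no
    \<open>E h k\<close>, and adds at most one point to each fibre.\<close>
  define f where "f h = (\<lambda>x\<in>X. LEAST k. x \<in> E h k \<or> to_nat_on X x = k)" for h
  have f_D: "f h \<in> D_fun X J" for h
  proof -
    have "{x\<in>X. f h x = n} \<in> J" for n
    proof (rule ideal_on_subset[OF J])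
      show "{x\<in>X. f h x = n} \<subseteq> E h n \<union> {x\<in>X. to_nat_on X x = n}"
      proof
        fix x assume "x \<in> {x\<in>X. f h x = n}"
        then have x: "x \<in> X" "(LEAST k. x \<in> E h k \<or> to_nat_on X x = k) = n"
          by (auto simp: f_def)
        show "x \<in> E h n \<union> {x\<in>X. to_nat_on X x = n}"
          using LeastI[of "\<lambda>k. x \<in> E h k \<or> to_nat_on X x = k" "to_nat_on X x"] x by auto
      qed
      have "finite {x\<in>X. to_nat_on X x = n}"
        using inj_on_to_nat_on[OF X]
        by (intro finite_subset[of "{x\<in>X. to_nat_on X x = n}" "{from_nat_into X n}"])
          (auto simp: X)
      then show "E h n \<union> {x\<in>X. to_nat_on X x = n} \<in> J"
        by (intro ideal_on_Un[OF J] E ideal_on_finite[OF J]) auto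
    qed
    then show ?thesis
      by (simp add: D_fun_def) (simp add: f_def)
  qed
  have "f ` D \<notin> unbounded_families X J"
  proof
    assume *: "f ` D \<in> unbounded_families X J"
    then have "unbounded_families X J \<noteq> {}"
      by auto
    from least_card_attained[OF this, folded bounding_number_def] obtain A where
      "bounding_number X J = |A|" "\<forall>B\<in>unbounded_families X J. |A| \<le>o |B|"
      by (elim bexE conjE) (rule that)
    then have "bounding_number X J \<le>o |f ` D|"
      using * by simp
    also have "|f ` D| \<le>o |D|"
      by (rule card_of_image)
    also have "|D| \<le>o dominating_number"
      using D ..
    finally show False
      using b by contradiction
  qed
  then obtain g where g: "g \<in> D_fun X J" "\<And>h. h \<in> D \<Longrightarrow> le_mod X J g (f h)"
    using f_D by (auto simp: unbounded_families_def)
  have fib: "{x\<in>X. g x = n} \<in> J" for n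
    using g(1) by (simp add: D_fun_def)
  show ?thesis
  \<comment> \<open>The shift turns \<open>g x \<le> f h' x\<close> into a strict inequality, so
    that minimality of \<open>f h' x\<close> excludes \<open>x\<close> from
    \<open>E h' (g x - 1)\<close>. It fails to lower \<open>g\<close> only on the fibre
    \<open>g x = 0\<close>, which lies in \<open>J\<close>.\<close>
  proof (intro exI[of _ "\<lambda>x. g x - 1"] conjI allI)
    fix n
    have "{x\<in>X. g x - 1 \<le> n} = (\<Union>i\<in>{..Suc n}. {x\<in>X. g x = i})"
      by auto
    then show "{x\<in>X. g x - 1 \<le> n} \<in> J"
      using ideal_on_finite_UN[OF J _ fib, of "{..Suc n}"] by simp
  next
    fix h
    obtain h' where h': "h' \<in> D" "h \<le> h'"
      using D by auto
    have "{x\<in>X. x \<in> E h (g x - 1)} \<subseteq> {x\<in>X. g x > f h' x} \<union> {x\<in>X. g x = 0}"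
    proof
      fix x assume "x \<in> {x\<in>X. x \<in> E h (g x - 1)}"
      then have x: "x \<in> X" "x \<in> E h' (g x - 1)"
        using monoD[OF mono h'(2)] by (auto simp: le_fun_def)
      then have "f h' x \<le> g x - 1"
        by (auto simp: f_def intro: Least_le)
      then show "x \<in> {x\<in>X. g x > f h' x} \<union> {x\<in>X. g x = 0}"
        using x by auto
    qed
    moreover have "{x\<in>X. g x > f h' x} \<union> {x\<in>X. g x = 0} \<in> J"
      using g(2)[OF h'(1)] fib by (intro ideal_on_Un[OF J]) (auto simp: le_mod_def)
    ultimately show "{x\<in>X. x \<in> E h (g x - 1)} \<in> J"
      by (rule ideal_on_subset[OF J, rotated])
  qed
qed

section \<open>Approximation of Borel sets modulo an ideal\<close>

text \<open>The strict inequality allows \<open>z x\<close> to be defined from the truth of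
  \<open>z \<in> c x\<close> by recursion along the enumeration.\<close>

definition causal :: "'a set \<Rightarrow> ('a \<Rightarrow> ('a \<Rightarrow> bool) set) \<Rightarrow> bool" where
  "causal X c \<longleftrightarrow>
     (\<forall>x\<in>X. \<forall>z\<in>X \<rightarrow>\<^sub>E UNIV. \<forall>z'\<in>X \<rightarrow>\<^sub>E UNIV.
        (\<forall>y\<in>X. to_nat_on X y < to_nat_on X x \<longrightarrow> z y = z' y) \<longrightarrow> (z \<in> c x \<longleftrightarrow> z' \<in> c x))"

text \<open>\<open>c\<close> converges to \<open>C\<close> pointwise modulo \<open>J\<close>. Demanding the monotone bound \<open>e\<close> on the exceptional
  sets makes the cofinality of the errors at most the dominating number, although there may be more
  points than that.\<close>

definition approximable :: "'a set \<Rightarrow> 'a set set \<Rightarrow> ('a \<Rightarrow> bool) set \<Rightarrow> bool" where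
  "approximable X J C \<longleftrightarrow>
     (\<exists>c (e :: (nat \<Rightarrow> nat) \<Rightarrow> 'a set). causal X c \<and> mono e \<and> range e \<subseteq> J \<and>
        (\<forall>z\<in>X \<rightarrow>\<^sub>E UNIV. \<exists>h. {x\<in>X. (z \<in> c x) \<noteq> (z \<in> C)} \<subseteq> e h))"

lemma approximable_Diff:
  assumes "approximable X J C"
  shows "approximable X J ((X \<rightarrow>\<^sub>E UNIV) - C)"
proof -
  obtain c e where c: "causal X c" "mono (e :: (nat \<Rightarrow> nat) \<Rightarrow> 'a set)" "range e \<subseteq> J"
    "\<forall>z\<in>X \<rightarrow>\<^sub>E UNIV. \<exists>h. {x\<in>X. (z \<in> c x) \<noteq> (z \<in> C)} \<subseteq> e h"
    using assms unfolding approximable_def by (elim exE conjE) (rule that)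
  show ?thesis
    unfolding approximable_def
  proof (intro exI[of _ "\<lambda>x. - c x"] exI[of _ e] conjI ballI c(2,3))
    show "causal X (\<lambda>x. - c x)"
      using c(1) unfolding causal_def Compl_iff by blast
  next
    fix z assume z: "z \<in> X \<rightarrow>\<^sub>E (UNIV :: bool set)"
    then have "{x\<in>X. (z \<in> - c x) \<noteq> (z \<in> (X \<rightarrow>\<^sub>E UNIV) - C)} = {x\<in>X. (z \<in> c x) \<noteq> (z \<in> C)}"
      by simp
    then show "\<exists>h. {x\<in>X. (z \<in> - c x) \<noteq> (z \<in> (X \<rightarrow>\<^sub>E UNIV) - C)} \<subseteq> e h"
      using c(4) z by simp
  qed
qed

lemma approximable_Un:
  assumes J: "ideal_on X J" and "approximable X J C" "approximable X J C'"
  shows "approximable X J (C \<union> C')"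
proof -
  obtain c e where c: "causal X c" "mono (e :: (nat \<Rightarrow> nat) \<Rightarrow> 'a set)" "range e \<subseteq> J"
    "\<forall>z\<in>X \<rightarrow>\<^sub>E UNIV. \<exists>h. {x\<in>X. (z \<in> c x) \<noteq> (z \<in> C)} \<subseteq> e h"
    using assms(2) unfolding approximable_def by (elim exE conjE) (rule that)
  obtain c' e' where c': "causal X c'" "mono (e' :: (nat \<Rightarrow> nat) \<Rightarrow> 'a set)" "range e' \<subseteq> J"
    "\<forall>z\<in>X \<rightarrow>\<^sub>E UNIV. \<exists>h. {x\<in>X. (z \<in> c' x) \<noteq> (z \<in> C')} \<subseteq> e' h"
    using assms(3) unfolding approximable_def by (elim exE conjE) (rule that)
  show ?thesis
    unfolding approximable_def
  proof (intro exI[of _ "\<lambda>x. c x \<union> c' x"] exI[of _ "\<lambda>h. e h \<union> e' h"] conjI ballI)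
    show "causal X (\<lambda>x. c x \<union> c' x)"
      using c(1) c'(1) unfolding causal_def Un_iff by blast
    show "mono (\<lambda>h. e h \<union> e' h)"
      using c(2) c'(2) unfolding mono_def by blast
    show "range (\<lambda>h. e h \<union> e' h) \<subseteq> J"
      using c(3) c'(3) by (auto intro: ideal_on_Un[OF J])
  next
    fix z assume z: "z \<in> X \<rightarrow>\<^sub>E (UNIV :: bool set)"
    obtain h h' where
      "{x\<in>X. (z \<in> c x) \<noteq> (z \<in> C)} \<subseteq> e h" "{x\<in>X. (z \<in> c' x) \<noteq> (z \<in> C')} \<subseteq> e' h'"
      using c(4) c'(4) z by blast
    moreover have "e h \<subseteq> e (sup h h')" "e' h' \<subseteq> e' (sup h h')"
      by (simp_all add: monoD c(2) c'(2))
    ultimately have "{x\<in>X. (z \<in> c x \<union> c' x) \<noteq> (z \<in> C \<union> C')} \<subseteq> e (sup h h') \<union> e' (sup h h')"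
      by blast
    then show "\<exists>h. {x\<in>X. (z \<in> c x \<union> c' x) \<noteq> (z \<in> C \<union> C')} \<subseteq> e h \<union> e' h"
      by blast
  qed
qed

text \<open>Diagonalise: at \<open>x\<close> use the approximation of \<open>C (g x)\<close>. It
  errs at \<open>z\<close> only if \<open>g x\<close> is too small for \<open>C (g x)\<close> to
  have settled at \<open>z\<close>, or if \<open>c (g x) x\<close> itself errs; the choice of
  \<open>g\<close> keeps both kinds of points in \<open>J\<close>.\<close>

lemma approximable_limit:
  assumes b: "\<not> bounding_number X J \<le>o dominating_number"
    and X: "countable X" and J: "ideal_on X J"
    and C: "\<And>k. approximable X J (C k)"
    and lim: "\<And>z. z \<in> X \<rightarrow>\<^sub>E UNIV \<Longrightarrow> \<forall>\<^sub>F k in sequentially. (z \<in> C k) = (z \<in> C')"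
  shows "approximable X J C'"
proof -
  define Q where "Q k c e \<longleftrightarrow> causal X c \<and> mono e \<and> range e \<subseteq> J \<and>
      (\<forall>z\<in>X \<rightarrow>\<^sub>E UNIV. \<exists>h. {x\<in>X. (z \<in> c x) \<noteq> (z \<in> C k)} \<subseteq> e h)"
    for k c and e :: "(nat \<Rightarrow> nat) \<Rightarrow> 'a set"
  have "\<exists>c e. Q k c e" for k
    using C[of k] unfolding approximable_def Q_def .
  then obtain c e where Q: "\<And>k. Q k (c k) (e k)"
    by metis
  have c: "causal X (c k)" and e: "mono (e k)" "range (e k) \<subseteq> J"
    and ce: "\<forall>z\<in>X \<rightarrow>\<^sub>E UNIV. \<exists>h. {x\<in>X. (z \<in> c k x) \<noteq> (z \<in> C k)} \<subseteq> e k h" for k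
    using Q[of k] unfolding Q_def by simp_all
  \<comment> \<open>One \<open>h\<close> codes a whole sequence of functions, its
    \<open>k\<close>-th row being the index for \<open>e k\<close>, so a single parameter bounds the
    errors of all approximations.\<close>
  define E where "E h k = e k (\<lambda>j. h (prod_encode (k, j)))" for h :: "nat \<Rightarrow> nat" and k
  have mono: "mono E"
    unfolding E_def by (intro monoI le_funI monoD[OF e(1)]) (simp add: le_fun_def)
  have "E h k \<in> J" for h k
    using e(2)[of k] by (auto simp: E_def)
  from diagonalising_function[OF b X J this mono] obtain g
    where g: "(\<forall>n. {x\<in>X. g x \<le> n} \<in> J) \<and> (\<forall>h. {x\<in>X. x \<in> E h (g x)} \<in> J)" ..
  \<comment> \<open>The value \<open>h 0\<close> doubles as the stage from which the sets
    \<open>C k\<close> have settled at the given point.\<close>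
  define e' where "e' h = {x\<in>X. g x \<le> h 0} \<union> {x\<in>X. x \<in> E h (g x)}" for h
  show ?thesis
    unfolding approximable_def
  proof (intro exI[of _ "\<lambda>x. c (g x) x"] exI[of _ e'] conjI ballI)
    \<comment> \<open>The index \<open>g x\<close> depends on \<open>x\<close> alone and not on the
      argument \<open>z\<close>, so any \<open>g\<close> preserves causality.\<close>
    show "causal X (\<lambda>x. c (g x) x)"
      using c unfolding causal_def by blast
    show "range e' \<subseteq> J"
      using g by (auto simp: e'_def intro: ideal_on_Un[OF J])
    show "mono e'"
    proof (rule monoI)
      fix h h' :: "nat \<Rightarrow> nat" assume "h \<le> h'"
      then have "h 0 \<le> h' 0" "\<And>k. E h k \<subseteq> E h' k"
        using monoD[OF mono, of h h'] by (auto simp: le_fun_def)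
      then show "e' h \<subseteq> e' h'"
        unfolding e'_def using order_trans by blast
    qed
  next
    fix z assume z: "z \<in> X \<rightarrow>\<^sub>E (UNIV :: bool set)"
    obtain n where n: "\<And>k. k \<ge> n \<Longrightarrow> (z \<in> C k) = (z \<in> C')"
      using lim[OF z] by (auto simp: eventually_sequentially)
    have "\<forall>k. \<exists>h. {x\<in>X. (z \<in> c k x) \<noteq> (z \<in> C k)} \<subseteq> e k h"
      using ce z by simp
    from choice[OF this] obtain H
      where H: "\<forall>k. {x\<in>X. (z \<in> c k x) \<noteq> (z \<in> C k)} \<subseteq> e k (H k)" ..
    \<comment> \<open>Adding \<open>n\<close> makes \<open>h 0\<close> at least \<open>n\<close>,
      while row \<open>k\<close> of \<open>h\<close> still dominates \<open>H k\<close>.\<close>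
    define h where "h i = n + case_prod H (prod_decode i)" for i
    have eE: "e k (H k) \<subseteq> E h k" for k
      unfolding E_def by (rule monoD[OF e(1)]) (auto simp: h_def le_fun_def)
    have "{x\<in>X. (z \<in> c (g x) x) \<noteq> (z \<in> C')} \<subseteq> e' h"
    proof
      fix x assume x: "x \<in> {x\<in>X. (z \<in> c (g x) x) \<noteq> (z \<in> C')}"
      show "x \<in> e' h"
      proof (cases "n \<le> g x")
        case True
        then have "x \<in> e (g x) (H (g x))"
          using x n[OF True] H[rule_format, of "g x"] by auto
        then show ?thesis
          using x eE[of "g x"] by (auto simp: e'_def)
      next
        case False
        then show ?thesis
          using x by (auto simp: e'_def h_def)
      qed
    qed
    then show "\<exists>h. {x\<in>X. (z \<in> c (g x) x) \<noteq> (z \<in> C')} \<subseteq> e' h"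
      by blast
  qed
qed

text \<open>Once \<open>x\<close> comes after all of \<open>F\<close> in the enumeration,
  \<open>C\<close> itself is a legitimate value of \<open>c x\<close>. Only finitely many
  \<open>x\<close> come earlier; there the empty set serves as a default, and one finite set bounds
  all errors.\<close>

lemma approximable_finitely_determined:
  assumes X: "countable X" and J: "ideal_on X J" and F: "finite F" "F \<subseteq> X"
    and C: "\<And>z z'. z \<in> X \<rightarrow>\<^sub>E UNIV \<Longrightarrow> z' \<in> X \<rightarrow>\<^sub>E UNIV \<Longrightarrow> (\<And>y. y \<in> F \<Longrightarrow> z y = z' y) \<Longrightarrow>
      z \<in> C \<longleftrightarrow> z' \<in> C"
  shows "approximable X J C"
proof -
  define c where "c x = (if \<forall>y\<in>F. to_nat_on X y < to_nat_on X x then C else {})" for x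
  define B where "B = {x\<in>X. \<exists>y\<in>F. to_nat_on X x \<le> to_nat_on X y}"
  have "B \<subseteq> (\<Union>y\<in>F. from_nat_into X ` {..to_nat_on X y})"
  proof
    fix x assume "x \<in> B"
    then obtain y where "x \<in> X" "y \<in> F" "to_nat_on X x \<le> to_nat_on X y"
      by (auto simp: B_def)
    moreover have "x = from_nat_into X (to_nat_on X x)"
      using \<open>x \<in> X\<close> X by simp
    ultimately show "x \<in> (\<Union>y\<in>F. from_nat_into X ` {..to_nat_on X y})"
      by blast
  qed
  then have "finite B"
    by (rule finite_subset) (use F in auto)
  then have "B \<in> J"
    by (intro ideal_on_finite[OF J]) (auto simp: B_def)
  moreover have "causal X c"
    unfolding causal_def
  proof (intro ballI impI)
    fix x z z' assume *: "z \<in> X \<rightarrow>\<^sub>E (UNIV :: bool set)" "z' \<in> X \<rightarrow>\<^sub>E (UNIV :: bool set)"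
      "\<forall>y\<in>X. to_nat_on X y < to_nat_on X x \<longrightarrow> z y = z' y"
    show "(z \<in> c x) = (z' \<in> c x)"
    proof (cases "\<forall>y\<in>F. to_nat_on X y < to_nat_on X x")
      case True
      then have "\<And>y. y \<in> F \<Longrightarrow> z y = z' y"
        using * F(2) by blast
      then show ?thesis
        using C[OF *(1,2)] by (simp add: c_def)
    qed (simp only: c_def if_False empty_iff)
  qed
  moreover have "{x\<in>X. (z \<in> c x) \<noteq> (z \<in> C)} \<subseteq> B" for z
    by (auto simp: c_def B_def not_less split: if_splits)
  ultimately show ?thesis
    unfolding approximable_def
    by (intro exI[of _ c] exI[of _ "\<lambda>_. B"]) (auto simp: mono_def)
qed

text \<open>The finite partial unions are approximable and eventually constant at each
  point.\<close>

lemma approximable_UN: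
  fixes C :: "nat \<Rightarrow> ('a \<Rightarrow> bool) set"
  assumes b: "\<not> bounding_number X J \<le>o dominating_number"
    and X: "countable X" and J: "ideal_on X J"
    and C: "\<And>k. approximable X J (C k)"
  shows "approximable X J (\<Union>k. C k)"
proof (rule approximable_limit[OF b X J, where C = "\<lambda>n. \<Union>k\<le>n. C k"])
  show "approximable X J (\<Union>k\<le>n. C k)" for n
    by (induction n) (auto simp: atMost_Suc C intro: approximable_Un[OF J])
  show "\<forall>\<^sub>F n in sequentially. (z \<in> (\<Union>k\<le>n. C k)) = (z \<in> (\<Union>k. C k))" for z
  proof (cases "z \<in> (\<Union>k. C k)")
    case True
    then obtain k where "z \<in> C k" by blast
    then show ?thesis
      unfolding eventually_sequentially by (intro exI[of _ k]) blast
  qed auto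
qed

text \<open>An open set is the union of the cylinders it contains, and there are only countably many
  cylinders, each determined by finitely many coordinates.\<close>

lemma approximable_openin:
  assumes b: "\<not> bounding_number X J \<le>o dominating_number"
    and X: "countable X" and J: "ideal_on X J"
    and U: "openin (cantor_space X) U"
  shows "approximable X J U"
proof -
  define cyl where "cyl = (\<lambda>(F, G). {z \<in> X \<rightarrow>\<^sub>E UNIV. \<forall>x\<in>F. z x \<longleftrightarrow> x \<in> G})"
  define P where "P = {A. finite A \<and> A \<subseteq> X}"
  define K where "K = {p \<in> P \<times> P. cyl p \<subseteq> U}"
  have "countable P"
    unfolding P_def using countable_Collect_finite_subset[OF X] by (simp add: conj_commute)
  then have K: "countable K"
    unfolding K_def by (intro countable_subset[OF _ countable_SIGMA[of P "\<lambda>_. P"]]) auto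
  have "U \<subseteq> (\<Union>p\<in>K. cyl p)"
  proof
    fix z assume zU: "z \<in> U"
    then obtain V where V: "finite {i \<in> X. V i \<noteq> UNIV}" "z \<in> Pi\<^sub>E X V" "Pi\<^sub>E X V \<subseteq> U"
      using U unfolding cantor_space_def openin_product_topology_alt by auto
    define F where "F = {i \<in> X. V i \<noteq> UNIV}"
    \<comment> \<open>The basic box around \<open>z\<close> restricts only the coordinates in
      \<open>F\<close>; fixing the values of \<open>z\<close> there gives a cylinder inside
      it.\<close>
    define p where "p = (F, {x\<in>F. z x})"
    have "cyl p \<subseteq> Pi\<^sub>E X V"
    proof
      fix w assume "w \<in> cyl p"
      then have w: "w \<in> X \<rightarrow>\<^sub>E UNIV" "\<And>x. x \<in> F \<Longrightarrow> w x = z x"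
        by (auto simp: cyl_def p_def)
      have "w x \<in> V x" if "x \<in> X" for x
        using that w(2)[of x] V(2) by (cases "x \<in> F") (auto simp: F_def PiE_iff)
      then show "w \<in> Pi\<^sub>E X V"
        using w(1) by (auto simp: PiE_iff)
    qed
    moreover have "z \<in> cyl p"
      using V(2) by (auto simp: cyl_def p_def PiE_iff)
    moreover have "p \<in> P \<times> P"
      using V(1) by (auto simp: p_def P_def F_def intro: rev_finite_subset)
    ultimately show "z \<in> (\<Union>p\<in>K. cyl p)"
      using V(3) unfolding K_def by blast
  qed
  then have U_eq: "U = (\<Union>p\<in>K. cyl p)"
    by (auto simp: K_def)
  have cyl: "approximable X J (cyl p)" if "p \<in> K" for p
  proof -
    obtain F G where p: "p = (F, G)"
      by (cases p)
    then have F: "finite F" "F \<subseteq> X"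
      using that by (simp_all add: K_def P_def)
    show ?thesis
      by (rule approximable_finitely_determined[OF X J F]) (auto simp: cyl_def p)
  qed
  show ?thesis
  proof (cases "K = {}")
    case True
    then have "U = {}" using U_eq by simp
    then show ?thesis
      using approximable_finitely_determined[OF X J, of "{}" "{}"] by simp
  next
    case False
    have "approximable X J (\<Union>n. cyl (from_nat_into K n))"
      by (intro approximable_UN[OF b X J] cyl from_nat_into False)
    moreover have "(\<Union>n. cyl (from_nat_into K n)) = U"
      unfolding U_eq using range_from_nat_into[OF False K] by (metis image_image)
    ultimately show ?thesis by simp
  qed
qed

lemma approximable_borel:
  assumes b: "\<not> bounding_number X J \<le>o dominating_number"
    and X: "countable X" and J: "ideal_on X J"
    and S: "S \<in> borel_sets_of (cantor_space X)"
  shows "approximable X J S"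
  using S unfolding borel_sets_of_def
proof (induction S rule: sigma_sets.induct)
  case (Basic U)
  then show ?case by (auto intro: approximable_openin[OF b X J])
next
  case Empty
  show ?case by (rule approximable_openin[OF b X J]) simp
next
  case (Compl S)
  then show ?case by (simp add: topspace_cantor_space approximable_Diff)
next
  case (Union S)
  then show ?case by (intro approximable_UN[OF b X J])
qed

section \<open>The recursive fixed point and the inequality under Borel separation\<close>

lemma causalD:
  assumes "causal X c" "x \<in> X" "z \<in> X \<rightarrow>\<^sub>E UNIV" "z' \<in> X \<rightarrow>\<^sub>E UNIV"
    and "\<And>y. y \<in> X \<Longrightarrow> to_nat_on X y < to_nat_on X x \<Longrightarrow> z y = z' y"
  shows "z \<in> c x \<longleftrightarrow> z' \<in> c x"
  using assms(1)[unfolded causal_def, rule_format, OF assms(2-4) assms(5)] .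

text \<open>Iterate the operator sending \<open>z\<close> to the function
  \<open>x \<mapsto> z \<in> c x\<close>. By causality the \<open>n\<close>-th iterate is final at
  all points of index below \<open>n\<close>, whatever the start, so the final values glue to a
  fixed point.\<close>

lemma causal_fixed_point:
  assumes c: "causal X c"
  shows "\<exists>z\<in>X \<rightarrow>\<^sub>E UNIV. \<forall>x\<in>X. z x \<longleftrightarrow> z \<in> c x"
proof -
  define Z where "Z n = ((\<lambda>z. \<lambda>x\<in>X. z \<in> c x) ^^ n) (\<lambda>x\<in>X. False)" for n
  have Z_Suc: "Z (Suc n) = (\<lambda>x\<in>X. Z n \<in> c x)" for n
    by (simp add: Z_def)
  have Z_ext: "Z n \<in> X \<rightarrow>\<^sub>E UNIV" for n
    by (cases n) (auto simp: Z_def)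
  have step: "Z (Suc n) x = Z n x" if "x \<in> X" "to_nat_on X x < n" for n x
    using that
  proof (induction n arbitrary: x)
    case (Suc n)
    have "Z (Suc n) \<in> c x \<longleftrightarrow> Z n \<in> c x"
    proof (rule causalD[OF c Suc.prems(1) Z_ext Z_ext])
      fix y assume "y \<in> X" "to_nat_on X y < to_nat_on X x"
      then show "Z (Suc n) y = Z n y"
        using Suc.prems(2) by (intro Suc.IH) simp_all
    qed
    then show ?case
      using Suc.prems by (simp add: Z_Suc)
  qed simp
  \<comment> \<open>The iterate numbered one above the index of \<open>x\<close> is the first one
    guaranteed to be final at \<open>x\<close>.\<close>
  define z where "z = (\<lambda>x\<in>X. Z (Suc (to_nat_on X x)) x)"
  have agree: "z x = Z n x" if "x \<in> X" "to_nat_on X x < n" for x n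
    using that(2)
  proof (induction n)
    case (Suc n)
    then show ?case
      using step[OF that(1)] that(1) by (cases "to_nat_on X x = n") (auto simp: z_def)
  qed simp
  have z: "z \<in> X \<rightarrow>\<^sub>E UNIV"
    by (simp add: z_def)
  have "z x \<longleftrightarrow> z \<in> c x" if "x \<in> X" for x
  proof -
    have "z x \<longleftrightarrow> Z (to_nat_on X x) \<in> c x"
      using that by (simp add: z_def Z_Suc)
    also have "\<dots> \<longleftrightarrow> z \<in> c x"
      by (rule causalD[OF c that Z_ext z]) (simp add: agree)
    finally show ?thesis .
  qed
  with z show ?thesis by blast
qed

lemma bounding_number_le_dominating_number:
  assumes X: "countable X" and J: "ideal_on X J"
    and sep: "borel_separated X J (dual_filter X J)"
  shows "bounding_number X J \<le>o dominating_number"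
proof (rule ccontr)
  assume b: "\<not> bounding_number X J \<le>o dominating_number"
  obtain S where S: "S \<in> borel_sets_of (cantor_space X)" "char_fun X ` J \<subseteq> S"
    "char_fun X ` dual_filter X J \<inter> S = {}"
    using sep unfolding borel_separated_def by (elim bexE conjE) (rule that)
  obtain c e where c: "causal X c" and e: "range (e :: (nat \<Rightarrow> nat) \<Rightarrow> 'a set) \<subseteq> J"
    "\<forall>z\<in>X \<rightarrow>\<^sub>E UNIV. \<exists>h. {x\<in>X. (z \<in> c x) \<noteq> (z \<in> S)} \<subseteq> e h"
    using approximable_borel[OF b X J S(1)] unfolding approximable_def by (elim exE conjE) (rule that)
  from causal_fixed_point[OF c] obtain z
    where z: "z \<in> X \<rightarrow>\<^sub>E UNIV" "\<forall>x\<in>X. z x \<longleftrightarrow> z \<in> c x" ..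
  define A where "A = {x\<in>X. z x}"
  have zA: "z = char_fun X A"
    using z(1) by (intro ext) (simp add: char_fun_def A_def PiE_iff extensional_def)
  obtain h where h: "{x\<in>X. (z \<in> c x) \<noteq> (z \<in> S)} \<subseteq> e h"
    using bspec[OF e(2) z(1)] ..
  have err: "{x\<in>X. (z \<in> c x) \<noteq> (z \<in> S)} \<in> J"
    by (rule ideal_on_subset[OF J _ h]) (rule subsetD[OF e(1) rangeI])
  \<comment> \<open>By the fixed point property \<open>A\<close> consists of the \<open>x\<close>
    with \<open>z \<in> c x\<close>. The error set, which is in \<open>J\<close>, is therefore
    \<open>X - A\<close> if \<open>z \<in> S\<close> and \<open>A\<close> otherwise.\<close>
  show False
  proof (cases "z \<in> S")
    case True
    then have "{x\<in>X. (z \<in> c x) \<noteq> (z \<in> S)} = X - A"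
      using z(2) by (auto simp: A_def)
    then have "X - A \<in> J"
      using err by simp
    moreover have "A \<subseteq> X"
      by (auto simp: A_def)
    ultimately have "A \<in> dual_filter X J"
      by (simp add: dual_filter_def)
    then have "z \<in> char_fun X ` dual_filter X J"
      unfolding zA by (rule imageI)
    with True S(3) show False
      by (simp add: disjoint_iff)
  next
    case False
    then have "{x\<in>X. (z \<in> c x) \<noteq> (z \<in> S)} = A"
      using z(2) by (auto simp: A_def)
    then have "A \<in> J"
      using err by simp
    then have "z \<in> S"
      unfolding zA by (intro subsetD[OF S(2)] imageI)
    with False show False ..
  qed
qed

section \<open>Lusin's separation theorem\<close>

lemma baire_space_cylinder:
  assumes "openin baire_space U" "\<alpha> \<in> U"
  obtains n where "{h. \<forall>i<n. h i = \<alpha> i} \<subseteq> U"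
proof -
  obtain V where V: "finite {i. V i \<noteq> UNIV}" "\<alpha> \<in> Pi\<^sub>E UNIV V" "Pi\<^sub>E UNIV V \<subseteq> U"
    using assms unfolding baire_space_def openin_product_topology_alt by auto
  obtain n where n: "{i. V i \<noteq> UNIV} \<subseteq> {..<n}"
    using finite_nat_bounded[OF V(1)] ..
  have "{h. \<forall>i<n. h i = \<alpha> i} \<subseteq> Pi\<^sub>E UNIV V"
  proof
    fix h assume h: "h \<in> {h. \<forall>i<n. h i = \<alpha> i}"
    have "h i \<in> V i" for i
    proof (cases "V i = UNIV")
      case False
      then have "h i = \<alpha> i"
        using h n by blast
      then show ?thesis
        using V(2) by (simp add: PiE_iff)
    qed simp
    then show "h \<in> Pi\<^sub>E UNIV V" by auto
  qed
  also note V(3)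
  finally show thesis by (rule that)
qed

lemma borel_sets_of_UN:
  "(\<And>i :: nat. S i \<in> borel_sets_of T) \<Longrightarrow> (\<Union>i. S i) \<in> borel_sets_of T"
  unfolding borel_sets_of_def by (rule sigma_sets.Union)

lemma borel_sets_of_INT:
  fixes S :: "nat \<Rightarrow> 'b set"
  assumes "\<And>i. S i \<in> borel_sets_of T"
  shows "(\<Inter>i. S i) \<in> borel_sets_of T"
  using assms unfolding borel_sets_of_def
  by (intro sigma_sets_Inter) (auto dest: openin_subset)

text \<open>If the images of two cylinders cannot be separated, neither can those of some pair of
  one-step refinements. Iterating yields branches \<alpha>, \<beta> with no separation at any level;
  but disjoint open neighbourhoods of \<open>p \<alpha>\<close> and \<open>q \<beta>\<close>
  separate the images of small enough cylinders.\<close>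

lemma lusin_separation:
  assumes T: "Hausdorff_space T" and P: "analytic_in T P" and Q: "analytic_in T Q"
    and disj: "P \<inter> Q = {}"
  shows "\<exists>S\<in>borel_sets_of T. P \<subseteq> S \<and> Q \<inter> S = {}"
proof -
  define sep where "sep P Q \<longleftrightarrow> (\<exists>S\<in>borel_sets_of T. P \<subseteq> S \<and> Q \<inter> S = {})" for P Q
  have sep_UN: "sep (\<Union>i :: nat. P i) (\<Union>j :: nat. Q j)" if "\<And>i j. sep (P i) (Q j)" for P Q
  proof -
    have "\<forall>i j. \<exists>S. S \<in> borel_sets_of T \<and> P i \<subseteq> S \<and> Q j \<inter> S = {}"
      using that by (simp add: sep_def Bex_def)
    then obtain S where S: "\<And>i j. S i j \<in> borel_sets_of T \<and> P i \<subseteq> S i j \<and> Q j \<inter> S i j = {}"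
      by metis
    show ?thesis
      unfolding sep_def
    proof (intro bexI conjI)
      \<comment> \<open>For each \<open>i\<close> the intersection over \<open>j\<close> still
        covers \<open>P i\<close> and misses every \<open>Q j\<close>.\<close>
      show "(\<Union>i. \<Inter>j. S i j) \<in> borel_sets_of T"
        by (intro borel_sets_of_UN borel_sets_of_INT conjunct1[OF S])
    qed (use S in blast)+
  qed
  have borel_empty: "{} \<in> borel_sets_of T" and borel_top: "topspace T \<in> borel_sets_of T"
    and borel_open: "\<And>U. openin T U \<Longrightarrow> U \<in> borel_sets_of T"
    by (auto simp: borel_sets_of_def intro: sigma_sets.Empty sigma_sets_top)
  \<comment> \<open>Only nonempty analytic sets are images of the Baire space, so the empty ones are
    treated apart.\<close>
  consider "P = {}" | "Q = {}" | "P \<noteq> {}" "Q \<noteq> {}" by blast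
  then have "sep P Q"
  proof cases
    case 1
    then show ?thesis using borel_empty by (auto simp: sep_def)
  next
    case 2
    have "P \<subseteq> topspace T"
      using P by (auto simp: analytic_in_def continuous_map_def)
    then show ?thesis using 2 borel_top by (auto simp: sep_def)
  next
    case 3
    have top: "topspace baire_space = UNIV"
      by (simp add: baire_space_def)
    obtain p where p: "continuous_map baire_space T p" "P = range p"
      using P 3 by (auto simp: analytic_in_def top)
    obtain q where q: "continuous_map baire_space T q" "Q = range q"
      using Q 3 by (auto simp: analytic_in_def top)
    define N where "N \<alpha> n = {h :: nat \<Rightarrow> nat. \<forall>i<n. h i = \<alpha> i}" for \<alpha> n
    have N_split: "N \<alpha> n = (\<Union>i. N (\<alpha>(n := i)) (Suc n))" for \<alpha> n
      by (auto simp: N_def less_Suc_eq)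
    show ?thesis
    proof (rule ccontr)
      assume nsep: "\<not> sep P Q"
      \<comment> \<open>At stage \<open>n\<close> only the values below \<open>n\<close> matter for
        the cylinders; the next stage fixes the value at \<open>n\<close> and leaves the others
        alone.\<close>
      have "\<exists>x. \<forall>n. (case x n of (\<alpha>, \<beta>) \<Rightarrow> \<not> sep (p ` N \<alpha> n) (q ` N \<beta> n)) \<and>
          (\<exists>i j. x (Suc n) = ((fst (x n))(n := i), (snd (x n))(n := j)))"
      proof (rule dependent_nat_choice)
        have "N \<alpha> 0 = UNIV" for \<alpha>
          by (simp add: N_def)
        then show "\<exists>x. case x of (\<alpha>, \<beta>) \<Rightarrow> \<not> sep (p ` N \<alpha> 0) (q ` N \<beta> 0)"
          using nsep p(2) q(2) by auto
      next
        fix x :: "(nat \<Rightarrow> nat) \<times> (nat \<Rightarrow> nat)" and n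
        obtain \<alpha> \<beta> where x: "x = (\<alpha>, \<beta>)" by force
        assume "case x of (\<alpha>, \<beta>) \<Rightarrow> \<not> sep (p ` N \<alpha> n) (q ` N \<beta> n)"
        then have "\<not> sep (\<Union>i. p ` N (\<alpha>(n := i)) (Suc n)) (\<Union>j. q ` N (\<beta>(n := j)) (Suc n))"
          by (simp add: x N_split[of _ n] image_UN)
        then obtain i j where
          "\<not> sep (p ` N (\<alpha>(n := i)) (Suc n)) (q ` N (\<beta>(n := j)) (Suc n))"
          using sep_UN[of "\<lambda>i. p ` N (\<alpha>(n := i)) (Suc n)" "\<lambda>j. q ` N (\<beta>(n := j)) (Suc n)"]
          by blast
        then show "\<exists>y. (case y of (\<alpha>, \<beta>) \<Rightarrow> \<not> sep (p ` N \<alpha> (Suc n)) (q ` N \<beta> (Suc n))) \<and>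
          (\<exists>i j. y = ((fst x)(n := i), (snd x)(n := j)))"
          by (intro exI[of _ "(\<alpha>(n := i), \<beta>(n := j))"]) (auto simp: x)
      qed
      then obtain x where x: "\<And>n. \<not> sep (p ` N (fst (x n)) n) (q ` N (snd (x n)) n)"
        "\<And>n. \<exists>i j. x (Suc n) = ((fst (x n))(n := i), (snd (x n))(n := j))"
        by (auto simp: case_prod_beta)
      \<comment> \<open>Coordinate \<open>i\<close> is chosen in passing to stage
        \<open>Suc i\<close> and never changes afterwards.\<close>
      define \<alpha> where "\<alpha> i = fst (x (Suc i)) i" for i
      define \<beta> where "\<beta> i = snd (x (Suc i)) i" for i
      have agree: "fst (x n) i = \<alpha> i \<and> snd (x n) i = \<beta> i" if "i < n" for i n
        using that
      proof (induction n)
        case (Suc n)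
        then show ?case
          using x(2)[of n] by (cases "i = n") (auto simp: \<alpha>_def \<beta>_def)
      qed simp
      have "N (fst (x n)) n = N \<alpha> n" "N (snd (x n)) n = N \<beta> n" for n
        using agree by (auto simp: N_def)
      then have unsep: "\<not> sep (p ` N \<alpha> n) (q ` N \<beta> n)" for n
        using x(1)[of n] by simp
      have "p \<alpha> \<noteq> q \<beta>" "p \<alpha> \<in> topspace T" "q \<beta> \<in> topspace T"
        using disj p q by (auto simp: continuous_map_def top)
      then obtain U V where UV: "openin T U" "openin T V" "p \<alpha> \<in> U" "q \<beta> \<in> V" "disjnt U V"
        using T unfolding Hausdorff_space_def by metis
      obtain m where m: "N \<alpha> m \<subseteq> {h. p h \<in> U}"
        using baire_space_cylinder[of "{h. p h \<in> U}" \<alpha>] p(1) UV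
        by (auto simp: continuous_map_def top N_def)
      obtain n where n: "N \<beta> n \<subseteq> {h. q h \<in> V}"
        using baire_space_cylinder[of "{h. q h \<in> V}" \<beta>] q(1) UV
        by (auto simp: continuous_map_def top N_def)
      have "N \<alpha> (max m n) \<subseteq> N \<alpha> m" "N \<beta> (max m n) \<subseteq> N \<beta> n"
        by (auto simp: N_def)
      \<comment> \<open>The open set \<open>U\<close> is the separator: it contains the first image,
        while the second lies in \<open>V\<close>, disjoint from \<open>U\<close>.\<close>
      then have "sep (p ` N \<alpha> (max m n)) (q ` N \<beta> (max m n))"
        unfolding sep_def using m n UV borel_open[OF UV(1)]
        by (intro bexI[of _ U]) (auto simp: disjnt_iff)
      then show False
        using unsep by blast
    qed
  qed
  then show ?thesis
    by (simp add: sep_def)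
qed

section \<open>Analytic ideals\<close>

lemma analytic_in_continuous_image:
  assumes "analytic_in T A" "continuous_map T T' g"
  shows "analytic_in T' (g ` A)"
  using assms unfolding analytic_in_def by (metis continuous_map_compose image_comp image_empty)

text \<open>Complementation is coordinatewise negation, a continuous map of the Cantor space to
  itself, and it carries \<open>J\<close> onto the dual filter.\<close>

lemma analytic_family_dual_filter:
  assumes A: "analytic_family X J" and J: "J \<subseteq> Pow X"
  shows "analytic_family X (dual_filter X J)"
proof -
  define r where "r z = (\<lambda>x\<in>X. \<not> z x)" for z :: "'a \<Rightarrow> bool"
  have "continuous_map (cantor_space X) (cantor_space X) r"
    unfolding cantor_space_def continuous_map_componentwise
  proof (intro conjI ballI)
    show "r ` topspace (product_topology (\<lambda>_. discrete_topology UNIV) X) \<subseteq> extensional X"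
      by (auto simp: r_def)
    fix x assume x: "x \<in> X"
    have "continuous_map (product_topology (\<lambda>_. discrete_topology UNIV) X) (discrete_topology UNIV)
        (Not \<circ> (\<lambda>z. z x))"
      by (intro continuous_map_compose[OF continuous_map_product_projection[OF x]]) auto
    then show "continuous_map (product_topology (\<lambda>_. discrete_topology UNIV) X)
        (discrete_topology UNIV) (\<lambda>z. r z x)"
      using x by (simp add: r_def comp_def)
  qed
  then have "analytic_in (cantor_space X) (r ` char_fun X ` J)"
    using A unfolding analytic_family_def by (metis analytic_in_continuous_image)
  moreover have "r (char_fun X B) = char_fun X (X - B)" for B
    by (auto simp: r_def char_fun_def fun_eq_iff)
  moreover have "dual_filter X J = (\<lambda>B. X - B) ` J"
    using J by (auto simp: dual_filter_def image_iff double_diff)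
  ultimately show ?thesis
    by (simp add: analytic_family_def image_image)
qed

text \<open>A common member of the ideal and the dual filter would, together with its complement,
  put \<open>X\<close> into \<open>J\<close>. Hence the two analytic sets are disjoint and Lusin's
  theorem separates them.\<close>

lemma analytic_imp_borel_separated:
  assumes J: "ideal_on X J" and A: "analytic_family X J"
  shows "borel_separated X J (dual_filter X J)"
proof -
  have "Hausdorff_space (cantor_space X)"
    by (simp add: cantor_space_def Hausdorff_space_product_topology)
  moreover have "analytic_family X (dual_filter X J)"
    using A ideal_on_Pow[OF J] by (intro analytic_family_dual_filter) auto
  moreover have "char_fun X ` J \<inter> char_fun X ` dual_filter X J = {}"
  proof -
    have False if "B \<in> J" "B' \<in> dual_filter X J" "char_fun X B = char_fun X B'" for B B'
    proof -
      have sub: "B \<subseteq> X" "B' \<subseteq> X" and "X - B' \<in> J"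
        using that ideal_on_Pow[OF J] by (auto simp: dual_filter_def)
      have "x \<in> B \<longleftrightarrow> x \<in> B'" if "x \<in> X" for x
        using fun_cong[OF \<open>char_fun X B = char_fun X B'\<close>, of x] that by (simp add: char_fun_def)
      then have "B \<union> (X - B') = X"
        using sub by blast
      then show False
        using ideal_on_Un[OF J \<open>B \<in> J\<close> \<open>X - B' \<in> J\<close>] ideal_on_whole[OF J] by simp
    qed
    then show ?thesis by blast
  qed
  ultimately show ?thesis
    using A unfolding borel_separated_def analytic_family_def by (intro lusin_separation)
qed

theorem corollary5p5:
  shows "(\<forall>I :: nat set set.
            ideal_on UNIV I \<and> borel_separated UNIV I (dual_filter UNIV I)
              \<longrightarrow> bounding_number UNIV I \<le>o dominating_number) \<and>
         (\<forall>(X :: 'a set) J.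
            countable X \<and> ideal_on X J \<and> analytic_family X J
              \<longrightarrow> bounding_number X J \<le>o dominating_number)"
  by (auto intro!: bounding_number_le_dominating_number analytic_imp_borel_separated)

end
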